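(* Let $\eta\in(0,1)$ and $1<p\leq q<\infty$. Then there exists a positive constant $C$, which depends on $\eta$ but is independent of $r$ and $W$, such that, for any $r\in(0,\infty)$ and $W\in\mathscr{A}^{\mathrm{loc}}_{p,q}(r)$, $$[W]_{\mathscr{A}^{\mathrm{loc}}_{p,q}((1+\eta)r)}\le C\,[W]^2_{\mathscr{A}^{\mathrm{loc}}_{p,q}(r)}.$$
   Context: Cubes in $\mathbb{R}^n$ have edges parallel to the coordinate axes; $\ell(Q)$ is the edge length of $Q$; $\fint_Q f:=\frac1{|Q|}\int_Q f$; $p':=\frac{p}{p-1}$. Fix $n,m\in\mathbb{N}$ (constants may depend on $n,m,p,q$); $\|A\|$ is the operator norm of a complex $m\times m$ matrix acting on $\mathbb{C}^m$ with the Euclidean norm. A matrix weight is a map $W$ from $\mathbb{R}^n$ to the positive semidefinite complex $m\times m$ matrices whose entries are locally integrable and such that $W(x)$ is positive definite for almost every $x$; $W^\alpha(x):=(W(x))^\alpha$ ($\alpha\in\mathbb{R}$) is defined a.e. by diagonalization. For $r\in(0,\infty)$ and $1<p\le q<\infty$, $\mathscr{A}^{\mathrm{loc}}_{p,q}(r)$ is the set of all matrix weights $W$ with $$[W]_{\mathscr{A}^{\mathrm{loc}}_{p,q}(r)}:=\sup_{\mathrm{cubes}\ Q:\ \ell(Q)\le r}\fint_Q\left[\fint_Q\left\|W^{\frac1q}(x)W^{-\frac1q}(y)\right\|^{p'}dy\right]^{\frac q{p'}}dx<\infty.$$ *)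

theory Defs
  imports "HOL-Analysis.Analysis"
begin

definition conj_transpose :: "complex^'m^'k \<Rightarrow> complex^'k^'m"
  where "conj_transpose A = (\<chi> i j. cnj (A $ j $ i))"

definition herm_inner :: "complex^'m \<Rightarrow> complex^'m \<Rightarrow> complex"
  where "herm_inner x y = (\<Sum>i\<in>UNIV. cnj (x $ i) * y $ i)"

definition psd_matrix :: "complex^'m^'m \<Rightarrow> bool"
  where "psd_matrix A \<longleftrightarrow>
    conj_transpose A = A \<and> (\<forall>x. 0 \<le> Re (herm_inner x (A *v x)))"

definition pd_matrix :: "complex^'m^'m \<Rightarrow> bool"
  where "pd_matrix A \<longleftrightarrow>
    conj_transpose A = A \<and> (\<forall>x. x \<noteq> 0 \<longrightarrow> 0 < Re (herm_inner x (A *v x)))"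

definition unitary_matrix :: "complex^'m^'m \<Rightarrow> bool"
  where "unitary_matrix U \<longleftrightarrow>
    conj_transpose U ** U = mat 1 \<and> U ** conj_transpose U = mat 1"

definition real_diag :: "real^'m \<Rightarrow> complex^'m^'m"
  where "real_diag d = (\<chi> i j. if i = j then complex_of_real (d $ i) else 0)"

text \<open>
  Real powers by diagonalization. The result does not depend on the chosen
  diagonalization. It is only meaningful for positive definite \<open>A\<close>; otherwise no
  diagonalization with positive \<open>d\<close> exists and the value is arbitrary.
\<close>

definition matrix_rpow :: "complex^'m^'m \<Rightarrow> real \<Rightarrow> complex^'m^'m"
  where "matrix_rpow A \<alpha> = (THE B. \<exists>U d. unitary_matrix U \<and> (\<forall>i. 0 < d $ i) \<and>
    A = U ** real_diag d ** conj_transpose U \<and>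
    B = U ** real_diag (\<chi> i. (d $ i) powr \<alpha>) ** conj_transpose U)"

text \<open>
  The norm of \<^typ>\<open>complex^'m\<close> is the Euclidean norm of \<open>\<complex>\<^sup>m\<close>, so \<^const>\<open>onorm\<close>, a
  supremum over all vectors, is the operator norm over the complex numbers.
\<close>

definition matrix_opnorm :: "complex^'m^'m \<Rightarrow> real"
  where "matrix_opnorm A = onorm ((*v) A)"

definition cube :: "real^'n \<Rightarrow> real \<Rightarrow> (real^'n) set"
  where "cube a l = cbox a (\<chi> i. a $ i + l)"

definition avg :: "(real^'n) set \<Rightarrow> (real^'n \<Rightarrow> ennreal) \<Rightarrow> ennreal"
  where "avg Q f = (\<integral>\<^sup>+x\<in>Q. f x \<partial>lebesgue) / emeasure lebesgue Q"

text \<open>Powers on \<open>[0,\<infinity>]\<close>, for exponents \<open>a > 0\<close>.\<close>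

definition ennreal_rpow :: "ennreal \<Rightarrow> real \<Rightarrow> ennreal"
  where "ennreal_rpow x a = (if x = \<infinity> then \<infinity> else ennreal (enn2real x powr a))"

definition conj_exponent :: "real \<Rightarrow> real"
  where "conj_exponent p = p / (p - 1)"

definition matrix_weight :: "(real^'n \<Rightarrow> complex^'m^'m) \<Rightarrow> bool"
  where "matrix_weight W \<longleftrightarrow>
    (\<forall>x. psd_matrix (W x)) \<and>
    (\<forall>i j K. compact K \<longrightarrow> (\<lambda>x. W x $ i $ j) absolutely_integrable_on K) \<and>
    (AE x in lebesgue. pd_matrix (W x))"

definition A_loc_const ::
    "real \<Rightarrow> real \<Rightarrow> real \<Rightarrow> (real^'n \<Rightarrow> complex^'m^'m) \<Rightarrow> ennreal"
  where "A_loc_const p q r W =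
    (SUP (a, l) \<in> {(a, l). 0 < l \<and> l \<le> r}.
      avg (cube a l) (\<lambda>x.
        ennreal_rpow
          (avg (cube a l) (\<lambda>y.
            ennreal (matrix_opnorm
              (matrix_rpow (W x) (1 / q) ** matrix_rpow (W y) (- (1 / q))) powr conj_exponent p)))
          (q / conj_exponent p)))"

definition A_loc :: "real \<Rightarrow> real \<Rightarrow> real \<Rightarrow> (real^'n \<Rightarrow> complex^'m^'m) set"
  where "A_loc p q r = {W. matrix_weight W \<and> A_loc_const p q r W < \<infinity>}"

end

theory Submission
  imports Defs
begin

text \<open>
  Let \<open>N(x, y)\<close> be the operator norm of \<open>W\<^sup>1\<^sup>/\<^sup>q(x) W\<^sup>-\<^sup>1\<^sup>/\<^sup>q(y)\<close>, let \<open>p'\<close> be the conjugate exponent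
  of \<open>p\<close>, and let \<open>k = N\<^sup>p\<^sup>'\<close>. Inserting the identity \<open>W\<^sup>-\<^sup>1\<^sup>/\<^sup>q(z) W\<^sup>1\<^sup>/\<^sup>q(z)\<close> gives
  \<open>k(x, y) \<le> k(x, z) k(z, y)\<close> for almost every \<open>z\<close>.

  A cube \<open>Q\<close> with edge length \<open>l \<le> (1 + \<eta>) r\<close> is covered by its \<open>2\<^sup>n\<close> corner subcubes of edge length
  \<open>s = l / (1 + \<eta>) \<le> r\<close>. Since \<open>\<eta> < 1\<close>, all of these contain a common central cube \<open>P\<close> of edge length
  \<open>(1 - \<eta>) s\<close>. Two points \<open>x, y\<close> of \<open>Q\<close> lie in two possibly different corner cubes, and each of the
  factors \<open>k(x, z)\<close> and \<open>k(z, y)\<close> with \<open>z \<in> P\<close> involves only one corner cube. By Markov's inequality,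
  \<open>\<integral>\<^sub>Q k(z, y) dy\<close> is bounded by a constant for all \<open>z\<close> in at least half of \<open>P\<close>. Averaging over these
  \<open>z\<close> bounds \<open>\<integral>\<^sub>Q k(x, y) dy\<close> by a multiple of the average of \<open>k(x, z)\<close> over any corner cube, and it
  remains to raise this to the power \<open>q / p'\<close> and to integrate over \<open>x\<close>. The two factors each
  contribute the constant of \<open>W\<close> at scale \<open>r\<close> once, hence the square. This is
  \<open>submult_kernel_average_le\<close>, for submultiplicative kernels on a sigma-finite space.

  The argument needs joint measurability of \<open>k\<close>, that is, measurability of \<open>x \<mapsto> W\<^sup>\<alpha>(x)\<close>. It
  follows from the continuity of \<open>A \<mapsto> A\<^sup>\<alpha>\<close> on positive definite matrices
  (\<open>continuous_on_matrix_rpow\<close>), which rests on the spectral theorem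
  (\<open>pd_matrix_diagonalization\<close>) and the compactness of the unitary group.
\<close>

section \<open>Spectral decomposition of Hermitian matrices\<close>

lemma inner_eq_Re_herm_inner: "x \<bullet> y = Re (herm_inner x y)"
  for x y :: "complex^'m"
  by (simp add: herm_inner_def inner_vec_def inner_complex_def)

lemma herm_inner_self: "herm_inner x x = complex_of_real ((norm x)\<^sup>2)"
  for x :: "complex^'m"
proof (rule complex_eqI)
  show "Re (herm_inner x x) = Re (complex_of_real ((norm x)\<^sup>2))"
    by (simp flip: inner_eq_Re_herm_inner add: power2_norm_eq_inner)
  show "Im (herm_inner x x) = Im (complex_of_real ((norm x)\<^sup>2))"
    by (simp add: herm_inner_def)
qed

lemma herm_inner_add_right: "herm_inner x (y + z) = herm_inner x y + herm_inner x z"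
  by (simp add: herm_inner_def algebra_simps sum.distrib)

lemma herm_inner_smult_right: "herm_inner x (c *s y) = c * herm_inner x y"
  by (simp add: herm_inner_def sum_distrib_left algebra_simps)

lemma herm_inner_smult_left: "herm_inner (c *s x) y = cnj c * herm_inner x y"
  by (simp add: herm_inner_def sum_distrib_left algebra_simps)

lemma herm_inner_scaleR_right: "herm_inner x (c *\<^sub>R y) = c *\<^sub>R herm_inner x y"
  unfolding herm_inner_def vector_scaleR_component scaleR_sum_right by simp

lemma cnj_herm_inner: "cnj (herm_inner x y) = herm_inner y x"
  by (simp add: herm_inner_def algebra_simps)

lemma herm_inner_matrix_vector:
  fixes A :: "complex^'m^'m"
  shows "herm_inner x (A *v y) = herm_inner (conj_transpose A *v x) y"
proof -
  have "herm_inner x (A *v y) = (\<Sum>i\<in>UNIV. \<Sum>j\<in>UNIV. cnj (x $ i) * (A $ i $ j * y $ j))"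
    by (simp add: herm_inner_def matrix_vector_mult_def sum_distrib_left)
  also have "\<dots> = (\<Sum>j\<in>UNIV. \<Sum>i\<in>UNIV. cnj (x $ i) * (A $ i $ j * y $ j))"
    by (rule sum.swap)
  also have "\<dots> = herm_inner (conj_transpose A *v x) y"
    by (simp add: herm_inner_def matrix_vector_mult_def conj_transpose_def sum_distrib_right
        sum_distrib_left algebra_simps)
  finally show ?thesis .
qed

lemma continuous_on_matrix_vector [continuous_intros]:
  fixes A :: "complex^'m^'m"
  assumes "continuous_on S f"
  shows "continuous_on S (\<lambda>x. A *v f x)"
  using bounded_linear.continuous_on[OF matrix_vector_mul_bounded_linear assms] .

lemma continuous_on_herm_inner [continuous_intros]:
  fixes f g :: "'a::topological_space \<Rightarrow> complex^'m"
  assumes "continuous_on S f" "continuous_on S g"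
  shows "continuous_on S (\<lambda>x. herm_inner (f x) (g x))"
  unfolding herm_inner_def by (intro continuous_intros assms)

text \<open>
  Over the reals, \<open>\<complex>\<^sup>m\<close> has dimension \<open>2m\<close>, and \<open>k\<close> vectors together with their multiples
  by \<open>\<i>\<close> span a real subspace of dimension at most \<open>2k\<close>; real orthogonality to that subspace
  is complex orthogonality to the \<open>k\<close> vectors.
\<close>

lemma exists_herm_orthogonal:
  fixes u :: "'k \<Rightarrow> complex^'m"
  assumes "finite J" and "card J < CARD('m)"
  shows "\<exists>x. x \<noteq> 0 \<and> (\<forall>j\<in>J. herm_inner (u j) x = 0)"
proof -
  define T where "T = u ` J \<union> (\<lambda>j. \<i> *s u j) ` J"
  have fin: "finite T" using assms by (simp add: T_def)
  have "card T \<le> card (u ` J) + card ((\<lambda>j. \<i> *s u j) ` J)"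
    unfolding T_def by (rule card_Un_le)
  also have "\<dots> \<le> card J + card J"
    by (intro add_mono card_image_le assms)
  finally have "card T < DIM(complex^'m)" using assms(2) by simp
  with dim_le_card'[OF fin] have "dim T < DIM(complex^'m)" by linarith
  then obtain x where x: "x \<noteq> 0" "\<And>y. y \<in> span T \<Longrightarrow> orthogonal x y"
    using orthogonal_to_subspace_exists by blast
  have "herm_inner (u j) x = 0" if "j \<in> J" for j
  proof (rule complex_eqI)
    have "x \<bullet> u j = 0" "x \<bullet> (\<i> *s u j) = 0"
      using x(2)[of "u j"] x(2)[of "\<i> *s u j"] that
      by (auto simp: T_def orthogonal_def intro: span_base)
    then have "Re (herm_inner (u j) x) = 0" "Re (herm_inner (\<i> *s u j) x) = 0"
      by (simp_all flip: inner_eq_Re_herm_inner add: inner_commute)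
    then show "Re (herm_inner (u j) x) = Re 0" "Im (herm_inner (u j) x) = Im 0"
      by (simp_all add: herm_inner_smult_left)
  qed
  with x(1) show ?thesis by blast
qed

text \<open>
  A maximizer of the Rayleigh quotient on the orthogonal complement of some eigenvectors is
  again an eigenvector.
\<close>

lemma exists_orthogonal_eigenvector:
  fixes A :: "complex^'m^'m" and u :: "'k \<Rightarrow> complex^'m"
  assumes herm: "conj_transpose A = A" and J: "finite J" "card J < CARD('m)"
    and eig: "\<And>j. j \<in> J \<Longrightarrow> A *v u j = complex_of_real (d j) *s u j"
  shows "\<exists>v c. norm v = 1 \<and> (\<forall>j\<in>J. herm_inner (u j) v = 0) \<and>
    A *v v = complex_of_real c *s v"
proof -
  define S where "S = {x. \<forall>j\<in>J. herm_inner (u j) x = 0}"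
  have S_scale: "c *\<^sub>R x \<in> S" if "x \<in> S" for c x
    using that by (simp add: S_def herm_inner_scaleR_right)
  have S_add: "x + y \<in> S" if "x \<in> S" "y \<in> S" for x y
    using that by (simp add: S_def herm_inner_add_right)
  have S_A: "A *v x \<in> S" if "x \<in> S" for x
    using that by (simp add: S_def herm_inner_matrix_vector herm eig herm_inner_smult_left)
  have "closed S"
  proof -
    have "S = (\<Inter>j\<in>J. {x. herm_inner (u j) x = 0})" by (auto simp: S_def)
    then show ?thesis
      by (auto intro!: closed_INT closed_Collect_eq continuous_on_herm_inner)
  qed
  have comp: "compact (sphere 0 1 \<inter> S)"
    using \<open>closed S\<close> by (intro compact_Int_closed) auto
  obtain x0 where x0: "x0 \<noteq> 0" "x0 \<in> S"
    using exists_herm_orthogonal[OF J, of u] by (auto simp: S_def)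
  have "(1 / norm x0) *\<^sub>R x0 \<in> sphere 0 1 \<inter> S"
    using x0 S_scale by auto
  then have ne: "sphere 0 1 \<inter> S \<noteq> {}" by blast
  have cont: "continuous_on (sphere 0 1 \<inter> S) (\<lambda>x. x \<bullet> (A *v x))"
    by (intro continuous_intros)
  obtain v where v: "v \<in> S" "norm v = 1"
    and max: "\<And>x. x \<in> S \<Longrightarrow> norm x = 1 \<Longrightarrow> x \<bullet> (A *v x) \<le> v \<bullet> (A *v v)"
    using continuous_attains_sup[OF comp ne cont] by auto
  define c where "c = v \<bullet> (A *v v)"
  have max': "x \<bullet> (A *v x) \<le> c * (x \<bullet> x)" if "x \<in> S" for x
  proof (cases "x = 0")
    case False
    have "((1 / norm x) *\<^sub>R x) \<bullet> (A *v ((1 / norm x) *\<^sub>R x)) \<le> c"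
      unfolding c_def using False that by (intro max S_scale) auto
    then have "(x \<bullet> (A *v x)) / (norm x)\<^sup>2 \<le> c"
      by (simp add: linear_scale[OF matrix_vector_mul_linear] power2_eq_square)
    then show ?thesis
      using False by (simp add: divide_le_eq power2_norm_eq_inner)
  qed simp
  have symm: "x \<bullet> (A *v y) = (A *v x) \<bullet> y" for x y
    by (simp add: inner_eq_Re_herm_inner herm_inner_matrix_vector herm)
  define w where "w = A *v v - c *\<^sub>R v"
  have wS: "w \<in> S"
    using S_add[OF S_A[OF v(1)] S_scale[OF v(1), of "-c"]] by (simp add: w_def)
  \<comment> \<open>The function \<open>t \<mapsto> (v + t w) \<bullet> A (v + t w) - c |v + t w|\<^sup>2\<close> is at most 0 and vanishes at 0; its
    first-order coefficient is \<open>2 |w|\<^sup>2\<close>.\<close>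
  define b where "b = w \<bullet> (A *v w) - c * (w \<bullet> w)"
  have quad: "2 * t * (w \<bullet> w) + t\<^sup>2 * b \<le> 0" for t
  proof -
    have vv: "v \<bullet> v = 1" using v(2) by (simp flip: power2_norm_eq_inner)
    have symm_vw: "v \<bullet> (A *v w) = w \<bullet> (A *v v)"
      using symm[of v w] by (simp add: inner_commute)
    have "(v + t *\<^sub>R w) \<bullet> (A *v (v + t *\<^sub>R w)) \<le>
        c * ((v + t *\<^sub>R w) \<bullet> (v + t *\<^sub>R w))"
      by (intro max' S_add S_scale wS v(1))
    then have "2 * t * (w \<bullet> (A *v v) - c * (w \<bullet> v)) + t\<^sup>2 * b \<le> 0"
      using vv symm_vw c_def
      by (simp add: b_def matrix_vector_right_distrib linear_scale[OF matrix_vector_mul_linear]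
          inner_add_left inner_commute power2_eq_square algebra_simps)
    also have "w \<bullet> (A *v v) - c * (w \<bullet> v) = w \<bullet> w"
      by (subst (4) w_def) (simp add: inner_diff_right)
    finally show ?thesis .
  qed
  have "w \<bullet> w \<le> 0"
  proof (rule ccontr)
    assume pos: "\<not> w \<bullet> w \<le> 0"
    \<comment> \<open>Small enough for the quadratic term to be at most half of the linear one.\<close>
    define t where "t = (w \<bullet> w) / (\<bar>b\<bar> + 1)"
    have tpos: "t > 0"
      unfolding t_def using pos by (intro divide_pos_pos) linarith+
    have "t * \<bar>b\<bar> \<le> w \<bullet> w"
      using pos by (simp add: t_def field_simps mult_left_mono)
    then have "t * (t * \<bar>b\<bar>) \<le> t * (w \<bullet> w)" using tpos by simp
    moreover have "t\<^sup>2 * b \<ge> - (t * (t * \<bar>b\<bar>))"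
      using mult_left_mono[of "-\<bar>b\<bar>" b "t\<^sup>2"] by (simp add: power2_eq_square algebra_simps)
    moreover have "t * (w \<bullet> w) > 0" using tpos pos by (intro mult_pos_pos) linarith+
    ultimately show False using quad[of t] by linarith
  qed
  then have "w = 0" by (metis inner_eq_zero_iff inner_ge_zero order_antisym)
  then have "A *v v = complex_of_real c *s v"
    by (simp add: w_def vec_eq_iff) (simp add: scaleR_conv_of_real)
  then show ?thesis using v by (auto simp: S_def)
qed

lemma exists_orthonormal_eigenbasis:
  fixes A :: "complex^'m^'m"
  assumes herm: "conj_transpose A = A"
  shows "\<exists>(u :: 'm \<Rightarrow> complex^'m) d.
    (\<forall>i j. herm_inner (u i) (u j) = (if i = j then 1 else 0)) \<and>
    (\<forall>j. A *v u j = complex_of_real (d j) *s u j)"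
proof -
  have "\<exists>(u :: 'm \<Rightarrow> complex^'m) d.
      (\<forall>i\<in>J. \<forall>j\<in>J. herm_inner (u i) (u j) = (if i = j then 1 else 0)) \<and>
      (\<forall>j\<in>J. A *v u j = complex_of_real (d j) *s u j)" for J :: "'m set"
    using finite[of J]
  proof (induction J rule: finite_induct)
    case (insert a J)
    then obtain u :: "'m \<Rightarrow> complex^'m" and d where
      on: "\<And>i j. i \<in> J \<Longrightarrow> j \<in> J \<Longrightarrow> herm_inner (u i) (u j) = (if i = j then 1 else 0)"
      and eig: "\<And>j. j \<in> J \<Longrightarrow> A *v u j = complex_of_real (d j) *s u j"
      by blast
    have "card J < CARD('m)"
      using insert.hyps by (intro psubset_card_mono) auto
    with exists_orthogonal_eigenvector[where u=u and d=d, OF herm insert.hyps(1) _ eig]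
    obtain v c where v: "norm v = 1" "\<And>j. j \<in> J \<Longrightarrow> herm_inner (u j) v = 0"
      "A *v v = complex_of_real c *s v"
      by blast
    have v': "herm_inner v (u j) = 0" if "j \<in> J" for j
      using v(2)[OF that] cnj_herm_inner[of "u j" v] by simp
    have vv: "herm_inner v v = 1" using v(1) by (simp add: herm_inner_self)
    show ?case
      using insert.hyps(2) on eig v v' vv
      by (intro exI[of _ "u(a := v)"] exI[of _ "d(a := c)"]) auto
  qed auto
  from this[of UNIV] show ?thesis by auto
qed

lemma matrix_mult_real_diag: "(A ** real_diag d) $ i $ j = A $ i $ j * complex_of_real (d $ j)"
  by (simp add: matrix_matrix_mult_def real_diag_def mult_delta_right)

lemma real_diag_matrix_mult: "(real_diag d ** A) $ i $ j = complex_of_real (d $ i) * A $ i $ j"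
  by (simp add: matrix_matrix_mult_def real_diag_def mult_delta_left)

lemma pd_matrix_diagonalization:
  fixes A :: "complex^'m^'m"
  assumes "pd_matrix A"
  shows "\<exists>U d. unitary_matrix U \<and> (\<forall>i. 0 < d $ i) \<and>
    A = U ** real_diag d ** conj_transpose U"
proof -
  from assms have herm: "conj_transpose A = A"
    and pos: "\<And>x. x \<noteq> 0 \<Longrightarrow> 0 < Re (herm_inner x (A *v x))"
    by (auto simp: pd_matrix_def)
  obtain u :: "'m \<Rightarrow> complex^'m" and d where
    on: "\<And>i j. herm_inner (u i) (u j) = (if i = j then 1 else 0)"
    and eig: "\<And>j. A *v u j = complex_of_real (d j) *s u j"
    using exists_orthonormal_eigenbasis[OF herm] by blast
  define U :: "complex^'m^'m" where "U = (\<chi> i j. u j $ i)"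
  have left: "conj_transpose U ** U = mat 1"
    using on by (simp add: vec_eq_iff matrix_matrix_mult_def conj_transpose_def U_def mat_def
        herm_inner_def)
  then have right: "U ** conj_transpose U = mat 1"
    using matrix_left_right_inverse by blast
  have "u j \<noteq> 0" for j using on[of j j] by (auto simp: herm_inner_self)
  then have dpos: "0 < d j" for j
    using pos[of "u j"] on[of j j] by (simp add: eig herm_inner_smult_right)
  have "A ** U = U ** real_diag (\<chi> i. d i)"
  proof -
    have "(A ** U) $ i $ j = (A *v u j) $ i" for i j
      by (simp add: matrix_matrix_mult_def matrix_vector_mult_def U_def)
    then show ?thesis
      by (simp add: vec_eq_iff matrix_mult_real_diag eig) (simp add: U_def mult.commute)
  qed
  then have "A = U ** real_diag (\<chi> i. d i) ** conj_transpose U"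
    by (metis matrix_mul_assoc matrix_mul_rid right)
  with left right dpos show ?thesis
    by (intro exI[of _ U] exI[of _ "\<chi> i. d i"]) (auto simp: unitary_matrix_def)
qed

section \<open>Powers of positive definite matrices\<close>

lemma bounded_bilinear_matrix_mult:
  "bounded_bilinear ((**) :: complex^'m^'m \<Rightarrow> complex^'m^'m \<Rightarrow> complex^'m^'m)"
  unfolding bilinear_conv_bounded_bilinear[symmetric] bilinear_def linear_iff
  by (auto simp: vec_eq_iff matrix_matrix_mult_def sum.distrib algebra_simps scaleR_sum_right)

lemmas tendsto_matrix_mult = bounded_bilinear.tendsto[OF bounded_bilinear_matrix_mult]

lemma tendsto_conj_transpose:
  assumes "(f \<longlongrightarrow> A) F"
  shows "((\<lambda>x. conj_transpose (f x)) \<longlongrightarrow> conj_transpose A) F"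
  unfolding conj_transpose_def by (intro tendsto_intros assms)

lemma real_diag_mult: "real_diag d ** real_diag e = real_diag (\<chi> i. d $ i * e $ i)"
  by (simp add: vec_eq_iff real_diag_matrix_mult) (simp add: real_diag_def)

text \<open>The power obtained by diagonalization does not depend on the diagonalization.\<close>

lemma diag_powr_unique:
  fixes U V :: "complex^'m^'m"
  assumes U: "unitary_matrix U" and V: "unitary_matrix V"
    and pos: "\<And>i. 0 < d $ i" "\<And>i. 0 < e $ i"
    and eq: "U ** real_diag d ** conj_transpose U = V ** real_diag e ** conj_transpose V"
  shows "U ** real_diag (\<chi> i. (d $ i) powr \<alpha>) ** conj_transpose U =
    V ** real_diag (\<chi> i. (e $ i) powr \<alpha>) ** conj_transpose V"
proof -
  note UV = U[unfolded unitary_matrix_def] V[unfolded unitary_matrix_def]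
  define M where "M = conj_transpose V ** U"
  have VM: "V ** M = U" using UV by (simp add: M_def matrix_mul_assoc)
  have MU: "M ** conj_transpose U = conj_transpose V"
    using UV by (simp add: M_def flip: matrix_mul_assoc)
  have "M ** real_diag d = conj_transpose V ** (U ** real_diag d ** conj_transpose U) ** U"
    using UV by (simp add: M_def flip: matrix_mul_assoc)
  also have "\<dots> = (conj_transpose V ** V) ** real_diag e ** M"
    unfolding eq by (simp add: M_def matrix_mul_assoc)
  finally have comm: "M ** real_diag d = real_diag e ** M"
    using UV by simp
  \<comment> \<open>The intertwiner \<open>M\<close> only connects equal eigenvalues, so it also intertwines their powers.\<close>
  have "M ** real_diag (\<chi> i. (d $ i) powr \<alpha>) = real_diag (\<chi> i. (e $ i) powr \<alpha>) ** M"
  proof -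
    have "M $ i $ j = 0 \<or> d $ j = e $ i" for i j
    proof -
      have "M $ i $ j * complex_of_real (d $ j) = complex_of_real (e $ i) * M $ i $ j"
        using comm by (metis matrix_mult_real_diag real_diag_matrix_mult)
      then show ?thesis by (simp add: mult.commute)
    qed
    then show ?thesis
      by (simp add: vec_eq_iff matrix_mult_real_diag real_diag_matrix_mult) metis
  qed
  then have "V ** (M ** real_diag (\<chi> i. (d $ i) powr \<alpha>)) ** conj_transpose U =
      V ** (real_diag (\<chi> i. (e $ i) powr \<alpha>) ** M) ** conj_transpose U"
    by simp
  then show ?thesis
    using VM MU by (metis matrix_mul_assoc)
qed

lemma matrix_rpow_eq:
  assumes "unitary_matrix U" "\<And>i. 0 < d $ i" "A = U ** real_diag d ** conj_transpose U"
  shows "matrix_rpow A \<alpha> = U ** real_diag (\<chi> i. (d $ i) powr \<alpha>) ** conj_transpose U"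
  unfolding matrix_rpow_def
proof (rule the_equality)
  show "\<exists>U' d'. unitary_matrix U' \<and> (\<forall>i. 0 < d' $ i) \<and>
      A = U' ** real_diag d' ** conj_transpose U' \<and>
      U ** real_diag (\<chi> i. (d $ i) powr \<alpha>) ** conj_transpose U =
      U' ** real_diag (\<chi> i. (d' $ i) powr \<alpha>) ** conj_transpose U'"
    using assms by blast
next
  fix B
  assume "\<exists>U' d'. unitary_matrix U' \<and> (\<forall>i. 0 < d' $ i) \<and>
      A = U' ** real_diag d' ** conj_transpose U' \<and>
      B = U' ** real_diag (\<chi> i. (d' $ i) powr \<alpha>) ** conj_transpose U'"
  then obtain U' d' where *: "unitary_matrix U'" "\<And>i. 0 < d' $ i"
      "A = U' ** real_diag d' ** conj_transpose U'"
      "B = U' ** real_diag (\<chi> i. (d' $ i) powr \<alpha>) ** conj_transpose U'"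
    by blast
  show "B = U ** real_diag (\<chi> i. (d $ i) powr \<alpha>) ** conj_transpose U"
    unfolding *(4) using *(1-3) assms by (intro diag_powr_unique) auto
qed

lemma conj_transpose_conj_transpose [simp]: "conj_transpose (conj_transpose A) = A"
  by (simp add: conj_transpose_def vec_eq_iff)

lemma conj_transpose_mult: "conj_transpose (A ** B) = conj_transpose B ** conj_transpose A"
  by (simp add: conj_transpose_def vec_eq_iff matrix_matrix_mult_def mult.commute)

lemma conj_transpose_real_diag [simp]: "conj_transpose (real_diag d) = real_diag d"
  by (simp add: conj_transpose_def vec_eq_iff real_diag_def)

lemma pd_matrix_unitary_conj_diag:
  fixes A U :: "complex^'m^'m"
  assumes "pd_matrix A" and U: "unitary_matrix U"
  shows "0 < Re ((conj_transpose U ** A ** U) $ i $ i)"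
proof -
  define x where "x = U *v axis i 1"
  have "conj_transpose U *v x = axis i 1"
    using U by (simp add: x_def matrix_vector_mul_assoc unitary_matrix_def)
  then have "x \<noteq> 0" by (metis axis_eq_0_iff matrix_vector_mult_0_right zero_neq_one)
  then have "0 < Re (herm_inner x (A *v x))"
    using assms(1) by (simp add: pd_matrix_def)
  also have "herm_inner x (A *v x) = herm_inner (axis i 1) ((conj_transpose U ** A ** U) *v axis i 1)"
    by (simp add: x_def herm_inner_matrix_vector conj_transpose_mult flip: matrix_vector_mul_assoc)
  also have "\<dots> = (conj_transpose U ** A ** U) $ i $ i"
  proof -
    have "herm_inner (axis i 1) z = (\<Sum>k\<in>UNIV. if k = i then z $ k else 0)" for z :: "complex^'m"
      unfolding herm_inner_def by (rule sum.cong) (auto simp: axis_def)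
    then show ?thesis by (simp add: matrix_vector_mult_def) (simp add: axis_def mult_delta_right)
  qed
  finally show ?thesis .
qed

lemma pd_matrix_diag:
  fixes U :: "complex^'m^'m"
  assumes U: "unitary_matrix U" and d: "\<And>i. 0 < d $ i"
  shows "pd_matrix (U ** real_diag d ** conj_transpose U)"
  unfolding pd_matrix_def
proof (intro conjI allI impI)
  show "conj_transpose (U ** real_diag d ** conj_transpose U) = U ** real_diag d ** conj_transpose U"
    by (simp add: conj_transpose_mult matrix_mul_assoc)
  fix x :: "complex^'m" assume "x \<noteq> 0"
  define y where "y = conj_transpose U *v x"
  have "U *v y = x" using U by (simp add: y_def matrix_vector_mul_assoc unitary_matrix_def)
  with \<open>x \<noteq> 0\<close> have "y \<noteq> 0" by auto
  then obtain i where i: "y $ i \<noteq> 0" by (auto simp: vec_eq_iff)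
  have Dy: "(real_diag d *v y) $ i = complex_of_real (d $ i) * y $ i" for i
    by (simp add: matrix_vector_mult_def real_diag_def mult_delta_left)
  have "Re (herm_inner x ((U ** real_diag d ** conj_transpose U) *v x)) =
      Re (herm_inner y (real_diag d *v y))"
    by (simp add: y_def herm_inner_matrix_vector conj_transpose_mult
        flip: matrix_vector_mul_assoc)
  also have "\<dots> = (\<Sum>i\<in>UNIV. d $ i * (cmod (y $ i))\<^sup>2)"
    unfolding herm_inner_def Dy Re_sum
    by (intro sum.cong refl) (simp add: cmod_power2, simp add: power2_eq_square algebra_simps)
  also have "\<dots> > 0"
    using d i by (intro sum_pos2[of _ i] mult_nonneg_nonneg) (auto intro: less_imp_le)
  finally show "0 < Re (herm_inner x ((U ** real_diag d ** conj_transpose U) *v x))" .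
qed

lemma matrix_rpow_minus_mult:
  assumes "pd_matrix A"
  shows "matrix_rpow A (- \<alpha>) ** matrix_rpow A \<alpha> = mat 1"
proof -
  obtain U d where U: "unitary_matrix U" and d: "\<And>i. 0 < d $ i"
    and A: "A = U ** real_diag d ** conj_transpose U"
    using pd_matrix_diagonalization[OF assms] by blast
  have "matrix_rpow A (- \<alpha>) ** matrix_rpow A \<alpha> =
      U ** (real_diag (\<chi> i. (d $ i) powr - \<alpha>) ** (conj_transpose U ** U) **
        real_diag (\<chi> i. (d $ i) powr \<alpha>)) ** conj_transpose U"
    by (simp add: matrix_rpow_eq[OF U d A] matrix_mul_assoc)
  also have "conj_transpose U ** U = mat 1" using U by (simp add: unitary_matrix_def)
  also have "real_diag (\<chi> i. (d $ i) powr - \<alpha>) ** mat 1 ** real_diag (\<chi> i. (d $ i) powr \<alpha>) =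
      mat 1"
  proof -
    have "d $ i powr - \<alpha> * d $ i powr \<alpha> = 1" for i
      using d[of i] by (simp flip: powr_add)
    then show ?thesis
      by (simp add: real_diag_mult) (simp add: real_diag_def mat_def vec_eq_iff)
  qed
  finally show ?thesis using U by (simp add: unitary_matrix_def)
qed

text \<open>Without a positive diagonalization, the defining predicate of the power is empty.\<close>

lemma matrix_rpow_not_pd:
  assumes "\<not> pd_matrix A"
  shows "matrix_rpow A \<alpha> = (THE B. False)"
proof -
  have "\<not> (unitary_matrix U \<and> (\<forall>i. 0 < d $ i) \<and> A = U ** real_diag d ** conj_transpose U)" for U d
    using pd_matrix_diag assms by blast
  then show ?thesis unfolding matrix_rpow_def
    by (intro arg_cong[where f = The] ext) blast
qed

lemma bounded_unitary: "bounded {U :: complex^'m^'m. unitary_matrix U}"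
proof (rule boundedI)
  fix U :: "complex^'m^'m" assume "U \<in> {U. unitary_matrix U}"
  then have "(conj_transpose U ** U) $ j $ j = 1" for j
    by (simp add: unitary_matrix_def mat_def)
  then have col: "(\<Sum>k\<in>UNIV. (cmod (U $ k $ j))\<^sup>2) = 1" for j
  proof -
    have "complex_of_real (\<Sum>k\<in>UNIV. (cmod (U $ k $ j))\<^sup>2) = (conj_transpose U ** U) $ j $ j"
      unfolding matrix_matrix_mult_def conj_transpose_def of_real_sum
      by (simp add: complex_norm_square mult.commute del: of_real_power)
    then show ?thesis using \<open>\<And>j. (conj_transpose U ** U) $ j $ j = 1\<close>[of j] of_real_eq_1_iff by metis
  qed
  have "cmod (U $ i $ j) \<le> 1" for i j
  proof -
    have "(cmod (U $ i $ j))\<^sup>2 \<le> (\<Sum>k\<in>UNIV. (cmod (U $ k $ j))\<^sup>2)"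
      by (rule member_le_sum) auto
    then show ?thesis using col power2_le_imp_le[of "cmod (U $ i $ j)" 1] by simp
  qed
  then show "norm U \<le> norm ((\<chi> i j. 1) :: complex^'m^'m)"
    by (intro norm_le_componentwise_cart) simp
qed

text \<open>
  Along a sequence of positive definite matrices \<open>A\<^sub>n \<rightarrow> A\<close>, the diagonalizing unitary matrices
  have convergent subsequences, and the limit of any such subsequence diagonalizes \<open>A\<close>; the
  eigenvalues then converge too, to limits that are positive because \<open>A\<close> is positive definite.
\<close>

lemma continuous_on_matrix_rpow:
  "continuous_on {A :: complex^'m^'m. pd_matrix A} (\<lambda>A. matrix_rpow A \<alpha>)"
  unfolding continuous_on_sequentially o_def
proof (intro allI ballI impI, elim conjE)
  fix X :: "nat \<Rightarrow> complex^'m^'m" and A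
  assume "A \<in> {A. pd_matrix A}" and pdX: "\<forall>n. X n \<in> {A. pd_matrix A}" and lim: "X \<longlonglongrightarrow> A"
  then have pdA: "pd_matrix A" by simp
  show "(\<lambda>n. matrix_rpow (X n) \<alpha>) \<longlonglongrightarrow> matrix_rpow A \<alpha>"
  proof (rule ccontr)
    assume "\<not> ?thesis"
    then obtain e where e: "e > 0"
      and "\<not> (\<forall>\<^sub>F n in sequentially. dist (matrix_rpow (X n) \<alpha>) (matrix_rpow A \<alpha>) < e)"
      by (auto simp: tendsto_iff)
    then obtain r where r: "strict_mono (r :: nat \<Rightarrow> nat)"
      and far: "\<And>n. \<not> dist (matrix_rpow (X (r n)) \<alpha>) (matrix_rpow A \<alpha>) < e"
      using not_eventually_sequentiallyD by blast
    have "\<forall>n. \<exists>U d. unitary_matrix U \<and> (\<forall>i. 0 < d $ i) \<and>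
        X (r n) = U ** real_diag d ** conj_transpose U"
      using pdX pd_matrix_diagonalization by auto
    then obtain U d where U: "\<And>n. unitary_matrix (U n)" and d: "\<And>n i. 0 < d n $ i"
      and X: "\<And>n. X (r n) = U n ** real_diag (d n) ** conj_transpose (U n)"
      by metis
    have "bounded (range U)"
      using bounded_unitary by (rule bounded_subset) (use U in auto)
    then obtain V s where s: "strict_mono (s :: nat \<Rightarrow> nat)" and UV: "(\<lambda>n. U (s n)) \<longlonglongrightarrow> V"
      using bounded_imp_convergent_subsequence[of U] by (auto simp: o_def)
    note UV' = tendsto_conj_transpose[OF UV]
    have "conj_transpose V ** V = mat 1" "V ** conj_transpose V = mat 1"
      using tendsto_matrix_mult[OF UV' UV] tendsto_matrix_mult[OF UV UV'] U
      by (auto simp: unitary_matrix_def LIMSEQ_const_iff)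
    then have V: "unitary_matrix V" by (simp add: unitary_matrix_def)
    have XA: "(\<lambda>n. X (r (s n))) \<longlonglongrightarrow> A"
      using LIMSEQ_subseq_LIMSEQ[OF lim strict_mono_o[OF r s]] by (simp add: o_def)
    define D where "D = conj_transpose V ** A ** V"
    have UXU: "conj_transpose (U n) ** X (r n) ** U n = real_diag (d n)" for n
    proof -
      have "conj_transpose (U n) ** X (r n) ** U n =
          (conj_transpose (U n) ** U n) ** real_diag (d n) ** (conj_transpose (U n) ** U n)"
        by (simp add: X matrix_mul_assoc)
      then show ?thesis using U[of n] by (simp add: unitary_matrix_def)
    qed
    have "(\<lambda>n. conj_transpose (U (s n)) ** X (r (s n)) ** U (s n)) \<longlonglongrightarrow> D"
      unfolding D_def by (intro tendsto_matrix_mult UV UV' XA)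
    then have lim_diag: "(\<lambda>n. real_diag (d (s n))) \<longlonglongrightarrow> D" by (simp add: UXU)
    define c where "c = (\<chi> i. Re (D $ i $ i))"
    have lim_entry: "(\<lambda>n. real_diag (d (s n)) $ i $ j) \<longlonglongrightarrow> D $ i $ j" for i j
      by (intro tendsto_vec_nth lim_diag)
    have lim_d: "(\<lambda>n. d (s n) $ i) \<longlonglongrightarrow> c $ i" for i
      using tendsto_Re[OF lim_entry[of i i]] by (simp add: real_diag_def c_def)
    have "real_diag c = D"
    proof -
      have "(\<lambda>n. real_diag (d (s n)) $ i $ j) \<longlonglongrightarrow> real_diag c $ i $ j" for i j
        using tendsto_of_real[OF lim_d[of i], where 'a = complex] by (auto simp: real_diag_def)
      then have "real_diag c $ i $ j = D $ i $ j" for i j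
        using lim_entry by (rule LIMSEQ_unique)
      then show ?thesis by (simp add: vec_eq_iff)
    qed
    then have "V ** real_diag c ** conj_transpose V =
        (V ** conj_transpose V) ** A ** (V ** conj_transpose V)"
      by (simp add: D_def matrix_mul_assoc)
    then have A: "A = V ** real_diag c ** conj_transpose V"
      using V by (simp add: unitary_matrix_def)
    have c: "0 < c $ i" for i
      using pd_matrix_unitary_conj_diag[OF pdA V] by (simp add: c_def D_def)
    have "(\<lambda>n. matrix_rpow (X (r (s n))) \<alpha>) \<longlonglongrightarrow> matrix_rpow A \<alpha>"
    proof -
      have "(\<lambda>n. real_diag (\<chi> i. (d (s n) $ i) powr \<alpha>) $ i $ j)
          \<longlonglongrightarrow> real_diag (\<chi> i. (c $ i) powr \<alpha>) $ i $ j" for i j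
        using c[of i] by (auto simp: real_diag_def intro!: tendsto_of_real tendsto_powr lim_d)
      then have "(\<lambda>n. real_diag (\<chi> i. (d (s n) $ i) powr \<alpha>)) \<longlonglongrightarrow> real_diag (\<chi> i. (c $ i) powr \<alpha>)"
        by (intro vec_tendstoI)
      then show ?thesis
        unfolding matrix_rpow_eq[OF V c A] matrix_rpow_eq[OF U d X]
        by (intro tendsto_matrix_mult UV UV')
    qed
    then have "\<forall>\<^sub>F n in sequentially. dist (matrix_rpow (X (r (s n))) \<alpha>) (matrix_rpow A \<alpha>) < e"
      using e by (rule tendstoD)
    then show False using far by simp
  qed
qed

section \<open>Measurability of the matrix kernel\<close>

lemma matrix_opnorm_nonneg: "0 \<le> matrix_opnorm A"
  unfolding matrix_opnorm_def by (intro onorm_pos_le matrix_vector_mul_bounded_linear)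

lemma matrix_opnorm_mult: "matrix_opnorm (A ** B) \<le> matrix_opnorm A * matrix_opnorm B"
proof -
  have "(*v) (A ** B) = (*v) A \<circ> (*v) B"
    by (simp add: fun_eq_iff matrix_vector_mul_assoc)
  then show ?thesis
    unfolding matrix_opnorm_def using onorm_compose matrix_vector_mul_bounded_linear by metis
qed

lemma continuous_on_matrix_opnorm:
  "continuous_on UNIV (matrix_opnorm :: complex^'m^'m \<Rightarrow> real)"
proof -
  have "bounded_bilinear ((*v) :: complex^'m^'m \<Rightarrow> complex^'m \<Rightarrow> complex^'m)"
    unfolding bilinear_conv_bounded_bilinear[symmetric] bilinear_def linear_iff
    by (auto simp: vec_eq_iff matrix_vector_mult_def sum.distrib algebra_simps scaleR_sum_right)
  then obtain K where K: "K > 0"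
      "\<And>(A::complex^'m^'m) x. norm (A *v x) \<le> norm A * norm x * K"
    using bounded_bilinear.pos_bounded by blast
  have bound: "matrix_opnorm A \<le> K * norm A" for A :: "complex^'m^'m"
    unfolding matrix_opnorm_def
    using K by (intro onorm_bound) (auto simp: mult_ac)
  have tri: "matrix_opnorm A - matrix_opnorm B \<le> K * norm (A - B)" for A B :: "complex^'m^'m"
  proof -
    have "matrix_opnorm A = onorm (\<lambda>x. (A - B) *v x + B *v x)"
      by (simp add: matrix_opnorm_def flip: matrix_vector_mult_add_rdistrib)
    also have "\<dots> \<le> matrix_opnorm (A - B) + matrix_opnorm B"
      unfolding matrix_opnorm_def by (intro onorm_triangle matrix_vector_mul_bounded_linear)
    finally show ?thesis using bound[of "A - B"] by simp
  qed
  have "K-lipschitz_on UNIV (matrix_opnorm :: complex^'m^'m \<Rightarrow> real)"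
  proof (rule lipschitz_onI)
    fix A B :: "complex^'m^'m"
    show "dist (matrix_opnorm A) (matrix_opnorm B) \<le> K * dist A B"
      using tri[of A B] tri[of B A] by (simp add: dist_norm norm_minus_commute abs_le_iff)
  qed (use K in simp)
  then show ?thesis by (rule lipschitz_on_continuous_on)
qed

lemma sigma_finite_lebesgue: "sigma_finite_measure (lebesgue :: 'a::euclidean_space measure)"
proof
  define A :: "nat \<Rightarrow> 'a set" where "A n = cbox (- real n *\<^sub>R One) (real n *\<^sub>R One)" for n
  have "\<Union> (range A) = UNIV"
  proof -
    have "box (- (real n *\<^sub>R One)) (real n *\<^sub>R One) \<subseteq> A n" for n
      by (simp add: A_def box_subset_cbox)
    then have "(\<Union>n. box (- (real n *\<^sub>R One)) (real n *\<^sub>R One)) \<subseteq> \<Union> (range A)"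
      by (intro UN_mono) auto
    then show ?thesis unfolding UN_box_eq_UNIV by auto
  qed
  moreover have "emeasure lebesgue (A n) \<noteq> \<infinity>" for n
    by (simp add: A_def emeasure_lborel_cbox_eq)
  ultimately show "\<exists>A. countable A \<and> A \<subseteq> sets lebesgue \<and> \<Union> A = space (lebesgue :: 'a measure) \<and>
      (\<forall>a\<in>A. emeasure lebesgue a \<noteq> \<infinity>)"
    by (intro exI[of _ "range A"]) (auto simp: A_def)
qed

lemma borel_measurable_matrix_weight:
  fixes W :: "real^'n \<Rightarrow> complex^'m^'m"
  assumes "matrix_weight W"
  shows "W \<in> borel_measurable lebesgue"
proof -
  have entry: "(\<lambda>x. W x $ i $ j) \<in> borel_measurable lebesgue" for i j
  proof (rule borel_measurable_LIMSEQ_metric)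
    fix k :: nat
    have "(\<lambda>x. W x $ i $ j) absolutely_integrable_on cball 0 (real k)"
      using assms unfolding matrix_weight_def by (meson compact_cball)
    then show "(\<lambda>x. indicator (cball 0 (real k)) x *\<^sub>R W x $ i $ j) \<in> borel_measurable lebesgue"
      unfolding set_integrable_def by (rule borel_measurable_integrable)
  next
    fix x :: "real^'n"
    have "\<forall>\<^sub>F k in sequentially. indicator (cball 0 (real k)) x *\<^sub>R W x $ i $ j = W x $ i $ j"
      using eventually_ge_at_top[of "nat \<lceil>norm x\<rceil>"]
      by eventually_elim (auto simp: indicator_def nat_le_iff ceiling_le_iff)
    then show "(\<lambda>k. indicator (cball 0 (real k)) x *\<^sub>R W x $ i $ j) \<longlonglongrightarrow> W x $ i $ j"
      by (rule tendsto_eventually)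
  qed
  show ?thesis
    by (rule borel_measurable_euclidean_space[THEN iffD2])
      (auto simp: Basis_vec_def inner_axis intro!: borel_measurable_inner entry)
qed

text \<open>
  The points where \<open>W\<close> is positive definite form a measurable set, since the others are a null set
  and Lebesgue measure is complete; at the others the power is one constant matrix.
\<close>

lemma borel_measurable_matrix_rpow:
  fixes W :: "real^'n \<Rightarrow> complex^'m^'m"
  assumes W: "matrix_weight W"
  shows "(\<lambda>x. matrix_rpow (W x) \<alpha>) \<in> borel_measurable lebesgue"
proof -
  have "AE x in lebesgue. \<not> \<not> pd_matrix (W x)"
    using W by (simp add: matrix_weight_def)
  then have "Measurable.pred lebesgue (\<lambda>x. \<not> pd_matrix (W x))"
    unfolding AE_completion_iff by (rule sets_completion_AE)
  then have meas: "{x \<in> space lebesgue. pd_matrix (W x)} \<in> sets lebesgue"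
    unfolding pred_def using sets.compl_sets by (fastforce simp: set_diff_eq)
  have "W \<in> restrict_space lebesgue {x. pd_matrix (W x)} \<rightarrow>\<^sub>M restrict_space borel {A. pd_matrix A}"
    using borel_measurable_matrix_weight[OF W]
    by (intro measurable_restrict_space3) auto
  from measurable_compose[OF this borel_measurable_continuous_on_restrict[OF continuous_on_matrix_rpow]]
  have "(\<lambda>x. if pd_matrix (W x) then matrix_rpow (W x) \<alpha> else (THE B. False)) \<in> borel_measurable lebesgue"
    unfolding measurable_If_restrict_space_iff[OF meas] by simp
  also have "(\<lambda>x. if pd_matrix (W x) then matrix_rpow (W x) \<alpha> else (THE B. False)) =
      (\<lambda>x. matrix_rpow (W x) \<alpha>)"
    by (auto simp: matrix_rpow_not_pd)
  finally show ?thesis .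
qed

lemma borel_measurable_matrix_kernel:
  fixes W :: "real^'n \<Rightarrow> complex^'m^'m"
  assumes W: "matrix_weight W"
  shows "(\<lambda>(x, y). ennreal (matrix_opnorm (matrix_rpow (W x) \<alpha> ** matrix_rpow (W y) \<beta>) powr t))
    \<in> borel_measurable (lebesgue \<Otimes>\<^sub>M lebesgue)"
proof -
  note [measurable] = borel_measurable_matrix_rpow[OF W]
  have "continuous_on UNIV (\<lambda>x :: (complex^'m^'m) \<times> (complex^'m^'m). matrix_opnorm (fst x ** snd x))"
    by (intro continuous_on_compose2[OF continuous_on_matrix_opnorm]
        bounded_bilinear.continuous_on[OF bounded_bilinear_matrix_mult] continuous_intros) auto
  then have [measurable]: "(\<lambda>z. matrix_opnorm (matrix_rpow (W (fst z)) \<alpha> ** matrix_rpow (W (snd z)) \<beta>))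
      \<in> borel_measurable (lebesgue \<Otimes>\<^sub>M lebesgue)"
    by (intro borel_measurable_continuous_Pair[where H = "\<lambda>A B. matrix_opnorm (A ** B)"]) measurable
  show ?thesis by (simp add: case_prod_beta) measurable
qed

text \<open>
  The kernel is submultiplicative because \<open>W\<^sup>-\<^sup>\<alpha>(z) W\<^sup>\<alpha>(z)\<close> is the identity; nothing is needed of
  the outer points.
\<close>

lemma matrix_kernel_submult:
  assumes "pd_matrix (W z)" "0 \<le> t"
  shows "ennreal (matrix_opnorm (matrix_rpow (W x) \<alpha> ** matrix_rpow (W y) (- \<alpha>)) powr t) \<le>
    ennreal (matrix_opnorm (matrix_rpow (W x) \<alpha> ** matrix_rpow (W z) (- \<alpha>)) powr t) *
    ennreal (matrix_opnorm (matrix_rpow (W z) \<alpha> ** matrix_rpow (W y) (- \<alpha>)) powr t)"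
proof -
  have "matrix_rpow (W x) \<alpha> ** matrix_rpow (W y) (- \<alpha>) =
      matrix_rpow (W x) \<alpha> ** (matrix_rpow (W z) (- \<alpha>) ** matrix_rpow (W z) \<alpha>) ** matrix_rpow (W y) (- \<alpha>)"
    using assms by (simp add: matrix_rpow_minus_mult)
  also have "\<dots> = (matrix_rpow (W x) \<alpha> ** matrix_rpow (W z) (- \<alpha>)) **
      (matrix_rpow (W z) \<alpha> ** matrix_rpow (W y) (- \<alpha>))"
    by (simp add: matrix_mul_assoc)
  finally show ?thesis
    using matrix_opnorm_mult[of "matrix_rpow (W x) \<alpha> ** matrix_rpow (W z) (- \<alpha>)"
        "matrix_rpow (W z) \<alpha> ** matrix_rpow (W y) (- \<alpha>)"] assms(2)
    by (simp add: matrix_opnorm_nonneg powr_mono2 flip: ennreal_mult powr_mult)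
qed

section \<open>Submultiplicative kernels on overlapping sets\<close>

lemma ennreal_rpow_mono: "x \<le> y \<Longrightarrow> 0 \<le> a \<Longrightarrow> ennreal_rpow x a \<le> ennreal_rpow y a"
  by (cases x; cases y) (auto simp: ennreal_rpow_def top_unique intro!: powr_mono2)

lemma ennreal_rpow_mult:
  assumes "0 < a"
  shows "ennreal_rpow (x * y) a = ennreal_rpow x a * ennreal_rpow y a"
proof (cases "x = \<infinity> \<or> y = \<infinity>")
  case False
  then show ?thesis
    by (cases x; cases y) (auto simp: ennreal_rpow_def powr_mult simp flip: ennreal_mult)
next
  case True
  then show ?thesis using assms
    by (auto simp: ennreal_rpow_def ennreal_top_mult ennreal_mult_top ennreal_mult_eq_top_iff
        enn2real_eq_0_iff)
qed

lemma ennreal_rpow_rpow: "ennreal_rpow (ennreal_rpow x a) b = ennreal_rpow x (a * b)"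
  by (simp add: ennreal_rpow_def powr_powr)

lemma ennreal_rpow_1 [simp]: "ennreal_rpow x 1 = x"
  by (cases x) (auto simp: ennreal_rpow_def)

lemma borel_measurable_ennreal_rpow [measurable]:
  "(\<lambda>x. ennreal_rpow x a) \<in> borel_measurable borel"
  unfolding ennreal_rpow_def by measurable

lemma nn_integral_set_cover_le:
  assumes I: "finite I" and cover: "Q \<subseteq> (\<Union>i\<in>I. S i)"
    and S [measurable]: "\<And>i. i \<in> I \<Longrightarrow> S i \<in> sets M" and [measurable]: "f \<in> borel_measurable M"
  shows "(\<integral>\<^sup>+x\<in>Q. f x \<partial>M) \<le> (\<Sum>i\<in>I. \<integral>\<^sup>+x\<in>S i. f x \<partial>M)"
proof -
  have "(\<integral>\<^sup>+x\<in>Q. f x \<partial>M) \<le> (\<integral>\<^sup>+x. (\<Sum>i\<in>I. f x * indicator (S i) x) \<partial>M)"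
  proof (rule nn_integral_mono)
    fix x
    show "f x * indicator Q x \<le> (\<Sum>i\<in>I. f x * indicator (S i) x)"
    proof (cases "x \<in> Q")
      case True
      then obtain i where "i \<in> I" "x \<in> S i" using cover by auto
      then show ?thesis
        using True I member_le_sum[of i I "\<lambda>i. f x * indicator (S i) x"] by simp
    qed simp
  qed
  also have "\<dots> = (\<Sum>i\<in>I. \<integral>\<^sup>+x\<in>S i. f x \<partial>M)"
    by (rule nn_integral_sum) measurable
  finally show ?thesis .
qed

text \<open>
  Markov's inequality with a non-strict sublevel set, so that it also holds for \<open>K = 0\<close>.
\<close>

lemma emeasure_sublevel_ge_half:
  assumes [measurable]: "G \<in> borel_measurable M" "P \<in> sets M"
    and P: "emeasure M P = ennreal m" and "0 \<le> K" "0 \<le> m"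
    and int: "(\<integral>\<^sup>+x\<in>P. G x \<partial>M) \<le> ennreal (K * m / 2)"
  shows "ennreal (m / 2) \<le> emeasure M {x \<in> P. G x \<le> ennreal K}"
proof -
  have "{x \<in> P. G x \<le> ennreal K} = {x \<in> space M. x \<in> P \<and> G x \<le> ennreal K}"
    "{x \<in> P. ennreal K < G x} = {x \<in> space M. x \<in> P \<and> ennreal K < G x}"
    using sets.sets_into_space[OF assms(2)] by auto
  then have sets: "{x \<in> P. G x \<le> ennreal K} \<in> sets M" "{x \<in> P. ennreal K < G x} \<in> sets M"
    by simp_all
  have split: "ennreal m = emeasure M {x \<in> P. G x \<le> ennreal K} + emeasure M {x \<in> P. ennreal K < G x}"
    unfolding P[symmetric] using sets
    by (subst plus_emeasure) (auto intro!: arg_cong[where f = "emeasure M"])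
  have "emeasure M {x \<in> P. ennreal K < G x} \<le> ennreal (m / 2)"
  proof (cases "K = 0")
    case True
    then have "(\<integral>\<^sup>+x\<in>P. G x \<partial>M) = 0" using int by simp
    then have "AE x in M. G x * indicator P x = 0"
      by (subst (asm) nn_integral_0_iff_AE) auto
    then have "emeasure M {x \<in> P. ennreal K < G x} = 0"
      using sets True
      by (intro AE_iff_null_sets[THEN iffD2, THEN null_setsD1]) (auto elim!: eventually_mono)
    then show ?thesis by simp
  next
    case False
    then have K: "K > 0" using assms by simp
    have "ennreal K * emeasure M {x \<in> P. ennreal K < G x} =
        (\<integral>\<^sup>+x. ennreal K * indicator {x \<in> P. ennreal K < G x} x \<partial>M)"
      using sets by (simp add: nn_integral_cmult_indicator)
    also have "\<dots> \<le> (\<integral>\<^sup>+x\<in>P. G x \<partial>M)"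
      by (intro nn_integral_mono) (auto simp: indicator_def)
    also have "\<dots> \<le> ennreal K * ennreal (m / 2)"
      using int K by (simp flip: ennreal_mult')
    finally show ?thesis
      using K by (simp add: ennreal_mult_le_mult_iff)
  qed
  then have "ennreal m \<le> emeasure M {x \<in> P. G x \<le> ennreal K} + ennreal (m / 2)"
    unfolding split by (intro add_left_mono)
  also have "ennreal m = ennreal (m / 2) + ennreal (m / 2)"
    using assms by (simp flip: ennreal_plus)
  finally show ?thesis by simp
qed

text \<open>
  The common part \<open>P\<close> of the sets \<open>S i\<close> serves as a bridge between any two points of \<open>Q\<close>. On the
  set \<open>E\<close> of those \<open>z \<in> P\<close> at which the powers of the averages of \<open>k z\<close> over all the \<open>S i\<close> have a
  sum of at most twice the bound for the mean of that sum over \<open>P\<close>, the integral of \<open>k z\<close> over \<open>Q\<close> is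
  bounded by a constant. The integral of \<open>k x\<close> over \<open>Q\<close> is at most \<open>k x z\<close> times that constant for
  almost every \<open>z \<in> E\<close>; averaging over \<open>E\<close>, which has at least half the measure of \<open>P\<close>, leaves a
  multiple of the average of \<open>k x\<close> over any \<open>S i\<close>. One factor \<open>A\<close> comes from the choice of \<open>E\<close>, the
  other from the final integration in \<open>x\<close>.
\<close>

lemma (in sigma_finite_measure) submult_kernel_average_le:
  fixes k :: "'a \<Rightarrow> 'a \<Rightarrow> ennreal" and S :: "'i \<Rightarrow> 'a set"
  assumes meas [measurable]: "case_prod k \<in> borel_measurable (M \<Otimes>\<^sub>M M)"
    and sub: "AE z in M. \<forall>x y. k x y \<le> k x z * k z y"
    and I: "finite I" "I \<noteq> {}"
    and sets: "\<And>i. i \<in> I \<Longrightarrow> S i \<in> sets M" "Q \<in> sets M" "P \<in> sets M"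
    and cover: "Q \<subseteq> (\<Union>i\<in>I. S i)" and P: "\<And>i. i \<in> I \<Longrightarrow> P \<subseteq> S i"
    and em: "\<And>i. i \<in> I \<Longrightarrow> emeasure M (S i) = ennreal s" "emeasure M Q = ennreal v"
      "emeasure M P = ennreal (c * s)"
    and pos: "0 < s" "s \<le> v" "0 < c" "0 < \<beta>"
    and A: "\<And>i. i \<in> I \<Longrightarrow>
      (\<integral>\<^sup>+x\<in>S i. ennreal_rpow ((\<integral>\<^sup>+y\<in>S i. k x y \<partial>M) / ennreal s) \<beta> \<partial>M) / ennreal s \<le> A"
  shows "(\<integral>\<^sup>+x\<in>Q. ennreal_rpow ((\<integral>\<^sup>+y\<in>Q. k x y \<partial>M) / ennreal v) \<beta> \<partial>M) / ennreal v
    \<le> ennreal (2 * (real (card I))\<^sup>2 / c * (2 * real (card I) / c) powr \<beta>) * A\<^sup>2"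
proof (cases "A = \<infinity>")
  case True
  then show ?thesis using I pos by (simp add: ennreal_mult_top power2_eq_square card_gt_0_iff)
next
  case False
  then obtain a where a: "A = ennreal a" "0 \<le> a" by (cases A) auto
  define N where "N = real (card I)"
  have N: "N > 0" using I by (simp add: N_def card_gt_0_iff)
  note [measurable] = sets(2,3)
  have [measurable]: "S i \<in> sets M" if "i \<in> I" for i using that by (rule sets)
  define \<phi> where "\<phi> = (\<lambda>i x. (\<integral>\<^sup>+y\<in>S i. k x y \<partial>M) / ennreal s)"
  have \<phi>_meas [measurable]: "\<phi> i \<in> borel_measurable M" if [simp]: "i \<in> I" for i
  proof -
    have [measurable]: "S i \<in> sets M" by (simp add: sets)
    show ?thesis unfolding \<phi>_def by measurable
  qed
  have \<phi>_int: "(\<integral>\<^sup>+x\<in>S i. ennreal_rpow (\<phi> i x) \<beta> \<partial>M) \<le> ennreal (a * s)" if "i \<in> I" for i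
  proof -
    have "(\<integral>\<^sup>+x\<in>S i. ennreal_rpow (\<phi> i x) \<beta> \<partial>M) =
        (\<integral>\<^sup>+x\<in>S i. ennreal_rpow (\<phi> i x) \<beta> \<partial>M) / ennreal s * ennreal s"
      using pos by (simp add: ennreal_divide_times mult_divide_eq_ennreal)
    also have "\<dots> \<le> A * ennreal s"
      using A[OF that] unfolding \<phi>_def by (rule mult_right_mono) simp
    finally show ?thesis using a pos by (simp add: ennreal_mult)
  qed
  define G where "G = (\<lambda>z. \<Sum>i\<in>I. ennreal_rpow (\<phi> i z) \<beta>)"
  have [measurable]: "G \<in> borel_measurable M" unfolding G_def by measurable
  \<comment> \<open>Chosen so that the integral of \<open>G\<close> over \<open>P\<close> is at most half of \<open>K\<close> times the measure of \<open>P\<close>.\<close>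
  define K where "K = 2 * N * a / c"
  have K: "K \<ge> 0" using N a pos by (simp add: K_def)
  define E where "E = {z \<in> P. G z \<le> ennreal K}"
  have E_sets [measurable]: "E \<in> sets M"
  proof -
    have "E = {z \<in> space M. z \<in> P \<and> G z \<le> ennreal K}"
      using sets.sets_into_space[OF sets(3)] by (auto simp: E_def)
    then show ?thesis by simp
  qed
  have E_large: "ennreal (c * s / 2) \<le> emeasure M E"
    unfolding E_def
  proof (rule emeasure_sublevel_ge_half)
    have "(\<integral>\<^sup>+x\<in>P. G x \<partial>M) = (\<integral>\<^sup>+x. (\<Sum>i\<in>I. ennreal_rpow (\<phi> i x) \<beta> * indicator P x) \<partial>M)"
      by (simp add: G_def sum_distrib_right)
    also have "\<dots> = (\<Sum>i\<in>I. \<integral>\<^sup>+x\<in>P. ennreal_rpow (\<phi> i x) \<beta> \<partial>M)"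
      by (rule nn_integral_sum) measurable
    also have "\<dots> \<le> (\<Sum>i\<in>I. \<integral>\<^sup>+x\<in>S i. ennreal_rpow (\<phi> i x) \<beta> \<partial>M)"
      using P by (intro sum_mono nn_integral_mono) (auto simp: indicator_def)
    also have "\<dots> \<le> (\<Sum>i\<in>I. ennreal (a * s))" by (intro sum_mono \<phi>_int)
    also have "\<dots> = ennreal (N * (a * s))"
      using a pos by (simp add: N_def ennreal_of_nat_eq_real_of_nat ennreal_mult)
    also have "N * (a * s) = K * (c * s) / 2" using pos by (simp add: K_def)
    finally show "(\<integral>\<^sup>+x\<in>P. G x \<partial>M) \<le> ennreal (K * (c * s) / 2)" .
  qed (use em pos K in auto)
  \<comment> \<open>Bounds the integral of \<open>k z\<close> over \<open>Q\<close> for every \<open>z \<in> E\<close>.\<close>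
  define L where "L = N * s * K powr (1 / \<beta>)"
  have L: "L \<ge> 0" using N pos by (simp add: L_def)
  have E_inner: "(\<integral>\<^sup>+y\<in>Q. k z y \<partial>M) \<le> ennreal L" if z: "z \<in> E" for z
  proof -
    have [measurable]: "z \<in> space M" using z E_sets sets.sets_into_space by blast
    have \<phi>_le: "\<phi> i z \<le> ennreal (K powr (1 / \<beta>))" if "i \<in> I" for i
    proof -
      have "ennreal_rpow (\<phi> i z) \<beta> \<le> G z"
        unfolding G_def using that I by (intro member_le_sum) auto
      also have "\<dots> \<le> ennreal K" using z by (simp add: E_def)
      finally have "ennreal_rpow (ennreal_rpow (\<phi> i z) \<beta>) (1 / \<beta>) \<le> ennreal_rpow (ennreal K) (1 / \<beta>)"
        using pos by (intro ennreal_rpow_mono) auto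
      then show ?thesis using pos K by (simp add: ennreal_rpow_rpow) (simp add: ennreal_rpow_def)
    qed
    have "(\<integral>\<^sup>+y\<in>Q. k z y \<partial>M) \<le> (\<Sum>i\<in>I. \<integral>\<^sup>+y\<in>S i. k z y \<partial>M)"
      by (intro nn_integral_set_cover_le I cover sets) measurable
    also have "\<dots> = (\<Sum>i\<in>I. \<phi> i z * ennreal s)"
      using pos by (intro sum.cong) (simp_all add: \<phi>_def ennreal_divide_times mult_divide_eq_ennreal)
    also have "\<dots> \<le> (\<Sum>i\<in>I. ennreal (K powr (1 / \<beta>)) * ennreal s)"
      by (intro sum_mono mult_right_mono \<phi>_le) auto
    also have "\<dots> = ennreal L"
      using pos N K by (simp add: L_def N_def ennreal_of_nat_eq_real_of_nat mult_ac flip: ennreal_mult)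
    finally show ?thesis .
  qed
  define D where "D = (2 * N / c) powr \<beta> * K"
  have D: "D \<ge> 0" using K by (simp add: D_def)
  have point: "ennreal_rpow ((\<integral>\<^sup>+y\<in>Q. k x y \<partial>M) / ennreal v) \<beta> \<le> ennreal D * ennreal_rpow (\<phi> i x) \<beta>"
    if x: "x \<in> space M" and i: "i \<in> I" for x i
  proof -
    note [measurable] = x
    have [measurable]: "S i \<in> sets M" by (rule sets(1)[OF i])
    define h where "h = (\<integral>\<^sup>+y\<in>Q. k x y \<partial>M)"
    have h_le: "AE z in M. z \<in> E \<longrightarrow> h \<le> k x z * ennreal L"
      using sub
    proof eventually_elim
      fix z assume kz: "\<forall>x y. k x y \<le> k x z * k z y"
      show "z \<in> E \<longrightarrow> h \<le> k x z * ennreal L"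
      proof
        assume z: "z \<in> E"
        then have [measurable]: "z \<in> space M" using E_sets sets.sets_into_space by blast
        have "h \<le> (\<integral>\<^sup>+y. k x z * (k z y * indicator Q y) \<partial>M)"
          unfolding h_def using kz by (intro nn_integral_mono) (auto simp: indicator_def)
        also have "\<dots> = k x z * (\<integral>\<^sup>+y\<in>Q. k z y \<partial>M)"
          by (rule nn_integral_cmult) measurable
        also have "\<dots> \<le> k x z * ennreal L"
          by (intro mult_left_mono E_inner z) auto
        finally show "h \<le> k x z * ennreal L" .
      qed
    qed
    have "h * ennreal (c * s / 2) \<le> h * emeasure M E"
      by (intro mult_left_mono E_large) auto
    also have "\<dots> = (\<integral>\<^sup>+z. h * indicator E z \<partial>M)"
      by (simp add: nn_integral_cmult_indicator)
    also have "\<dots> \<le> (\<integral>\<^sup>+z. ennreal L * (k x z * indicator (S i) z) \<partial>M)"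
      using h_le P[OF i]
      by (intro nn_integral_mono_AE) (auto elim!: eventually_mono simp: indicator_def E_def mult_ac)
    also have "\<dots> = ennreal L * (\<integral>\<^sup>+z\<in>S i. k x z \<partial>M)"
      by (rule nn_integral_cmult) measurable
    also have "(\<integral>\<^sup>+z\<in>S i. k x z \<partial>M) = \<phi> i x * ennreal s"
      using pos by (simp add: \<phi>_def ennreal_divide_times mult_divide_eq_ennreal)
    finally have hc: "h * ennreal (c * s / 2) \<le> ennreal L * (\<phi> i x * ennreal s)" .
    have "h / ennreal v \<le> h / ennreal s"
      using pos unfolding divide_ennreal_def
      by (intro mult_left_mono) (auto simp: inverse_ennreal intro!: ennreal_leI le_imp_inverse_le)
    also have "\<dots> = (h * ennreal (c * s / 2)) * ennreal (2 / (c * s * s))"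
      using pos by (simp add: divide_ennreal_def inverse_ennreal field_simps mult.assoc flip: ennreal_mult)
    also have "\<dots> \<le> (ennreal L * (\<phi> i x * ennreal s)) * ennreal (2 / (c * s * s))"
      by (intro mult_right_mono hc) auto
    also have "\<dots> = ennreal (L * s * (2 / (c * s * s))) * \<phi> i x"
    proof -
      have mult: "ennreal (L * s * w) = ennreal L * ennreal s * ennreal w" if "0 \<le> w" for w
        using that pos L by (simp add: ennreal_mult)
      have "ennreal (L * s * (2 / (c * s * s))) = ennreal L * ennreal s * ennreal (2 / (c * s * s))"
        using pos by (intro mult) simp
      then show ?thesis by (simp only: mult_ac)
    qed
    also have "L * s * (2 / (c * s * s)) = 2 * N / c * K powr (1 / \<beta>)"
      using pos by (simp add: L_def)
    finally have "ennreal_rpow (h / ennreal v) \<beta> \<le>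
        ennreal_rpow (ennreal (2 * N / c * K powr (1 / \<beta>)) * \<phi> i x) \<beta>"
      using pos by (intro ennreal_rpow_mono) auto
    also have "\<dots> = ennreal ((2 * N / c * K powr (1 / \<beta>)) powr \<beta>) * ennreal_rpow (\<phi> i x) \<beta>"
      using pos N by (simp add: ennreal_rpow_mult) (simp add: ennreal_rpow_def)
    also have "(2 * N / c * K powr (1 / \<beta>)) powr \<beta> = D"
      using pos N K powr_mult[of "2 * N / c" "K powr (1 / \<beta>)" \<beta>] by (simp add: D_def powr_powr)
    finally show ?thesis unfolding h_def .
  qed
  have "(\<integral>\<^sup>+x\<in>Q. ennreal_rpow ((\<integral>\<^sup>+y\<in>Q. k x y \<partial>M) / ennreal v) \<beta> \<partial>M) \<le>
      (\<Sum>i\<in>I. \<integral>\<^sup>+x\<in>S i. ennreal_rpow ((\<integral>\<^sup>+y\<in>Q. k x y \<partial>M) / ennreal v) \<beta> \<partial>M)"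
    by (intro nn_integral_set_cover_le I cover sets) measurable
  also have "\<dots> \<le> (\<Sum>i\<in>I. ennreal D * ennreal (a * s))"
  proof (intro sum_mono)
    fix i assume i: "i \<in> I"
    have [measurable]: "S i \<in> sets M" by (rule sets(1)[OF i])
    have [measurable]: "\<phi> i \<in> borel_measurable M" by (rule \<phi>_meas[OF i])
    have "(\<integral>\<^sup>+x\<in>S i. ennreal_rpow ((\<integral>\<^sup>+y\<in>Q. k x y \<partial>M) / ennreal v) \<beta> \<partial>M) \<le>
        (\<integral>\<^sup>+x. ennreal D * (ennreal_rpow (\<phi> i x) \<beta> * indicator (S i) x) \<partial>M)"
      using point i by (intro nn_integral_mono) (auto simp: indicator_def)
    also have "\<dots> = ennreal D * (\<integral>\<^sup>+x\<in>S i. ennreal_rpow (\<phi> i x) \<beta> \<partial>M)"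
      by (rule nn_integral_cmult) measurable
    also have "\<dots> \<le> ennreal D * ennreal (a * s)"
      by (intro mult_left_mono \<phi>_int i) auto
    finally show "(\<integral>\<^sup>+x\<in>S i. ennreal_rpow ((\<integral>\<^sup>+y\<in>Q. k x y \<partial>M) / ennreal v) \<beta> \<partial>M) \<le>
      ennreal D * ennreal (a * s)" .
  qed
  also have "\<dots> = ennreal (N * D * a * s)"
    using a pos D by (simp add: N_def ennreal_of_nat_eq_real_of_nat mult_ac flip: ennreal_mult)
  finally have "(\<integral>\<^sup>+x\<in>Q. ennreal_rpow ((\<integral>\<^sup>+y\<in>Q. k x y \<partial>M) / ennreal v) \<beta> \<partial>M) / ennreal v \<le>
      ennreal (N * D * a * s) / ennreal v"
    by (rule divide_right_mono_ennreal)
  also have "\<dots> = ennreal (N * D * a * (s / v))"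
    using pos N D a by (simp add: divide_ennreal)
  also have "\<dots> \<le> ennreal (N * D * a)"
    using pos N D a by (intro ennreal_leI mult_left_le) auto
  also have "N * D * a = 2 * N\<^sup>2 / c * (2 * N / c) powr \<beta> * a\<^sup>2"
    by (simp add: D_def K_def power2_eq_square)
  also have "ennreal \<dots> = ennreal (2 * N\<^sup>2 / c * (2 * N / c) powr \<beta>) * A\<^sup>2"
    unfolding a(1) ennreal_power[OF a(2)] using pos N by (intro ennreal_mult) auto
  finally show ?thesis by (simp add: N_def)
qed

section \<open>Covering a cube by overlapping subcubes\<close>

lemma mem_cube_iff: "x \<in> cube a l \<longleftrightarrow> (\<forall>i. a $ i \<le> x $ i \<and> x $ i \<le> a $ i + l)"
  by (simp add: cube_def mem_box_cart)

lemma sets_cube [measurable]: "cube a l \<in> sets lebesgue"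
  by (simp add: cube_def)

lemma emeasure_cube:
  fixes a :: "real^'n"
  assumes "0 \<le> l"
  shows "emeasure lebesgue (cube a l) = ennreal (l ^ CARD('n))"
proof -
  have "a \<in> cube a l" using assms by (simp add: mem_cube_iff)
  then have "measure lborel (cube a l) = l ^ CARD('n)"
    unfolding cube_def by (subst content_cbox_cart) auto
  moreover have "emeasure lebesgue (cube a l) = ennreal (measure lborel (cube a l))"
    by (simp add: cube_def emeasure_eq_ennreal_measure emeasure_lborel_cbox_eq)
  ultimately show ?thesis by simp
qed

text \<open>
  The \<open>2\<^sup>n\<close> subcubes of edge length \<open>s\<close> at the corners of the cube of edge length \<open>(1 + \<eta>) s\<close> with
  lower corner \<open>a\<close>; the set \<open>T\<close> consists of the coordinates in which the subcube is pushed to the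
  upper end.
\<close>

definition corner_cube :: "real \<Rightarrow> real^'n \<Rightarrow> real \<Rightarrow> 'n set \<Rightarrow> (real^'n) set"
  where "corner_cube \<eta> a s T = cube (\<chi> i. a $ i + (if i \<in> T then \<eta> * s else 0)) s"

lemma cube_subset_corner_cubes:
  fixes a :: "real^'n"
  assumes "\<eta> \<le> 1" "0 \<le> s"
  shows "cube a ((1 + \<eta>) * s) \<subseteq> (\<Union>T. corner_cube \<eta> a s T)"
proof
  fix x assume x: "x \<in> cube a ((1 + \<eta>) * s)"
  have "\<eta> * s \<le> s" using mult_right_mono[OF assms] by simp
  moreover have "a $ i \<le> x $ i" "x $ i \<le> a $ i + s + \<eta> * s" for i
    using x by (auto simp: mem_cube_iff distrib_right add.assoc)
  ultimately have "x \<in> corner_cube \<eta> a s {i. a $ i + s < x $ i}"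
    by (auto simp: corner_cube_def mem_cube_iff not_less intro: order_trans) (smt (verit))+
  then show "x \<in> (\<Union>T. corner_cube \<eta> a s T)" by blast
qed

lemma center_cube_subset_corner_cube:
  fixes a :: "real^'n"
  assumes "0 \<le> \<eta>" "0 \<le> s"
  shows "cube (\<chi> i. a $ i + \<eta> * s) ((1 - \<eta>) * s) \<subseteq> corner_cube \<eta> a s T"
proof
  fix x :: "real^'n" assume x: "x \<in> cube (\<chi> i. a $ i + \<eta> * s) ((1 - \<eta>) * s)"
  have "0 \<le> \<eta> * s" using assms by simp
  moreover have "a $ i + \<eta> * s \<le> x $ i" "x $ i \<le> a $ i + s" for i
    using x by (auto simp: mem_cube_iff left_diff_distrib)
  ultimately show "x \<in> corner_cube \<eta> a s T"
    by (auto simp: corner_cube_def mem_cube_iff intro: order_trans add_increasing2)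
qed

section \<open>Enlarging the scale\<close>

theorem theorem3p3:
  fixes \<eta> p q :: real
  assumes "0 < \<eta>" and "\<eta> < 1" and "1 < p" and "p \<le> q"
  shows "\<exists>C::real. 0 < C \<and>
    (\<forall>r>0. \<forall>W :: real^'n \<Rightarrow> complex^'m^'m. W \<in> A_loc p q r \<longrightarrow>
      A_loc_const p q ((1 + \<eta>) * r) W \<le> ennreal C * (A_loc_const p q r W)\<^sup>2)"
proof -
  define N where "N = real (card (UNIV :: 'n set set))"
  define c where "c = (1 - \<eta>) ^ CARD('n)"
  define \<beta> where "\<beta> = q / conj_exponent p"
  define C where "C = 2 * N\<^sup>2 / c * (2 * N / c) powr \<beta>"
  have c: "0 < c" using assms by (simp add: c_def)
  have N: "0 < N" by (simp add: N_def card_gt_0_iff)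
  have t: "0 < conj_exponent p" using assms by (simp add: conj_exponent_def)
  have \<beta>: "0 < \<beta>" using assms t by (simp add: \<beta>_def)
  have C: "0 < C" using N c by (simp add: C_def)
  have "A_loc_const p q ((1 + \<eta>) * r) W \<le> ennreal C * (A_loc_const p q r W)\<^sup>2"
    if r: "r > 0" and W: "W \<in> A_loc p q r" for r and W :: "real^'n \<Rightarrow> complex^'m^'m"
  proof -
    have W: "matrix_weight W" using W by (simp add: A_loc_def)
    define k where "k = (\<lambda>x y. ennreal (matrix_opnorm
      (matrix_rpow (W x) (1 / q) ** matrix_rpow (W y) (- (1 / q))) powr conj_exponent p))"
    define \<Psi> where "\<Psi> = (\<lambda>Q. avg Q (\<lambda>x. ennreal_rpow (avg Q (k x)) \<beta>))"
    have const: "A_loc_const p q R W = (SUP (a, l) \<in> {(a, l). 0 < l \<and> l \<le> R}. \<Psi> (cube a l))" for R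
      by (simp add: A_loc_const_def \<Psi>_def k_def \<beta>_def)
    show ?thesis
      unfolding const[of "(1 + \<eta>) * r"]
    proof (rule SUP_least, clarify)
      fix a :: "real^'n" and l :: real
      assume l: "0 < l" "l \<le> (1 + \<eta>) * r"
      \<comment> \<open>Cubes with \<open>l \<le> r\<close> are subdivided as well: for them the definition only gives a bound by the
        first power of the constant.\<close>
      define s where "s = l / (1 + \<eta>)"
      have s: "0 < s" "s \<le> r" "l = (1 + \<eta>) * s"
        using l assms by (auto simp: s_def field_simps)
      interpret sigma_finite_measure "lebesgue :: (real^'n) measure" by (rule sigma_finite_lebesgue)
      have "(\<integral>\<^sup>+x\<in>cube a l. ennreal_rpow ((\<integral>\<^sup>+y\<in>cube a l. k x y \<partial>lebesgue) /
          ennreal (l ^ CARD('n))) \<beta> \<partial>lebesgue) / ennreal (l ^ CARD('n)) \<le>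
        ennreal (2 * (real (card (UNIV :: 'n set set)))\<^sup>2 / c *
          (2 * real (card (UNIV :: 'n set set)) / c) powr \<beta>) * (A_loc_const p q r W)\<^sup>2"
      proof (rule submult_kernel_average_le[where s = "s ^ CARD('n)" and S = "corner_cube \<eta> a s"
            and P = "cube (\<chi> i. a $ i + \<eta> * s) ((1 - \<eta>) * s)"])
        show "case_prod k \<in> borel_measurable (lebesgue \<Otimes>\<^sub>M lebesgue)"
          unfolding k_def using borel_measurable_matrix_kernel[OF W] by simp
        show "AE z in lebesgue. \<forall>x y. k x y \<le> k x z * k z y"
        proof -
          have "AE z in lebesgue. pd_matrix (W z)" using W by (simp add: matrix_weight_def)
          then show ?thesis
            unfolding k_def by eventually_elim (intro allI matrix_kernel_submult, use t in auto)
        qed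
        show "cube a l \<subseteq> (\<Union>T. corner_cube \<eta> a s T)"
          unfolding s(3) using assms s by (intro cube_subset_corner_cubes) auto
        show "cube (\<chi> i. a $ i + \<eta> * s) ((1 - \<eta>) * s) \<subseteq> corner_cube \<eta> a s T" for T
          using assms s by (intro center_cube_subset_corner_cube) auto
        show em: "emeasure lebesgue (corner_cube \<eta> a s T) = ennreal (s ^ CARD('n))" for T
          unfolding corner_cube_def using s by (intro emeasure_cube) simp
        show "emeasure lebesgue (cube a l) = ennreal (l ^ CARD('n))"
          using l by (intro emeasure_cube) simp
        show "emeasure lebesgue (cube (\<chi> i. a $ i + \<eta> * s) ((1 - \<eta>) * s)) = ennreal (c * s ^ CARD('n))"
          using assms s by (subst emeasure_cube) (simp_all add: c_def power_mult_distrib)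
        show "s ^ CARD('n) \<le> l ^ CARD('n)"
          using assms s by (intro power_mono) auto
        show "(\<integral>\<^sup>+x\<in>corner_cube \<eta> a s T. ennreal_rpow ((\<integral>\<^sup>+y\<in>corner_cube \<eta> a s T. k x y \<partial>lebesgue) /
            ennreal (s ^ CARD('n))) \<beta> \<partial>lebesgue) / ennreal (s ^ CARD('n)) \<le> A_loc_const p q r W" for T
        proof -
          have "\<Psi> (corner_cube \<eta> a s T) \<le> A_loc_const p q r W"
            unfolding const corner_cube_def using s
            by (intro SUP_upper2[of "(\<chi> i. a $ i + (if i \<in> T then \<eta> * s else 0), s)"]) auto
          then show ?thesis unfolding \<Psi>_def avg_def em .
        qed
      qed (use s c \<beta> in \<open>auto simp: corner_cube_def\<close>)
      then show "\<Psi> (cube a l) \<le> ennreal C * (A_loc_const p q r W)\<^sup>2"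
        unfolding \<Psi>_def avg_def emeasure_cube[OF less_imp_le[OF l(1)]] C_def N_def .
    qed
  qed
  with C show ?thesis by blast
qed

end
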